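(* Let $R$ be a commutative ring with unity and let $l\geq 0$ be an integer. Let $\mathcal{Q}_1,\dots,\mathcal{Q}_k$ be nonzero ideals of $R$ such that $\mathrm{rad}(\mathcal{Q}_i)=\mathcal{M}_i$ for each $i$, where $\mathcal{M}_1,\dots,\mathcal{M}_k$ are pairwise distinct maximal ideals of $R$, and let $\mathcal{I}=\mathcal{Q}_1\mathcal{Q}_2\cdots\mathcal{Q}_k\neq 0$. Then the chinese remainder reduction map $$\mathbb{PF}^{l+1}_{\mathcal{I}}\longrightarrow \mathbb{PF}^{l+1}_{\mathcal{Q}_1}\times\mathbb{PF}^{l+1}_{\mathcal{Q}_2}\times\cdots\times\mathbb{PF}^{l+1}_{\mathcal{Q}_k},$$ sending the class of a unital tuple $(a_0,\dots,a_{l+1})$ modulo $\mathcal{I}$ to the tuple of its classes modulo each $\mathcal{Q}_i$, is surjective.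
   Context: A finite tuple $(a_0,\dots,a_n)$ of elements of $R$ is called unital if the ideal generated by $a_0,\dots,a_n$ is $R$. Let $\mathcal{INTRAD}(R)^*$ be the set of nonzero ideals of $R$ which are an (arbitrary) intersection of ideals whose radicals are pairwise distinct maximal ideals. For $0\neq\mathcal{I}\in\mathcal{INTRAD}(R)^*$ and $n\geq 0$, define on unital tuples in $R^{n+1}$ the relation $(a_0,\dots,a_n)\sim(b_0,\dots,b_n)$ iff $a_ib_j-a_jb_i\in\mathcal{I}$ for all $0\le i<j\le n$; this is an equivalence relation. The class of $(a_0,\dots,a_n)$ is written $[a_0:\dots:a_n]$ and the set of classes is the projective space $\mathbb{PF}^n_{\mathcal{I}}$. The ideals $\mathcal{Q}_i$ and $\mathcal{I}$ above lie in $\mathcal{INTRAD}(R)^*$; the reduction map is well defined since $\mathcal{I}\subseteq\mathcal{Q}_i$. *)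

theory Defs
  imports "HOL-Algebra.Ideal_Product"
begin

definition ideal_radical :: "('a, 'b) ring_scheme \<Rightarrow> 'a set \<Rightarrow> 'a set"
  where "ideal_radical R I = {x \<in> carrier R. \<exists>n::nat. x [^]\<^bsub>R\<^esub> n \<in> I}"

text \<open>The intersection is taken inside \<^term>\<open>carrier R\<close>, so the empty family yields the unit ideal.
  Injectivity of the radical on the family says that the radicals are pairwise distinct.\<close>

definition intrad :: "('a, 'b) ring_scheme \<Rightarrow> 'a set set"
  where "intrad R = {I. ideal I R \<and> I \<noteq> {\<zero>\<^bsub>R\<^esub>} \<and>
    (\<exists>F. (\<forall>Q\<in>F. ideal Q R \<and> maximalideal (ideal_radical R Q) R) \<and>
         inj_on (ideal_radical R) F \<and> I = carrier R \<inter> \<Inter>F)}"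

text \<open>Tuples \<open>(a\<^sub>0, \<dots>, a\<^sub>n)\<close> are functions on \<^term>\<open>{0..n}\<close>, \<^term>\<open>undefined\<close> elsewhere.\<close>

definition unital_tuples :: "('a, 'b) ring_scheme \<Rightarrow> nat \<Rightarrow> (nat \<Rightarrow> 'a) set"
  where "unital_tuples R n = {a \<in> {0..n} \<rightarrow>\<^sub>E carrier R. Idl\<^bsub>R\<^esub> (a ` {0..n}) = carrier R}"

definition proj_rel ::
    "('a, 'b) ring_scheme \<Rightarrow> 'a set \<Rightarrow> nat \<Rightarrow> ((nat \<Rightarrow> 'a) \<times> (nat \<Rightarrow> 'a)) set"
  where "proj_rel R I n = {(a, b). a \<in> unital_tuples R n \<and> b \<in> unital_tuples R n \<and>
    (\<forall>i j. 0 \<le> i \<and> i < j \<and> j \<le> n \<longrightarrow>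
      a i \<otimes>\<^bsub>R\<^esub> b j \<ominus>\<^bsub>R\<^esub> a j \<otimes>\<^bsub>R\<^esub> b i \<in> I)}"

text \<open>The definition makes sense for every ideal \<open>I\<close>; it is used for \<^prop>\<open>I \<in> intrad R\<close>,
  see \<open>ideal_in_intrad\<close> and \<open>ideal_product_in_intrad\<close> below.\<close>

definition proj_space :: "('a, 'b) ring_scheme \<Rightarrow> 'a set \<Rightarrow> nat \<Rightarrow> (nat \<Rightarrow> 'a) set set"
  where "proj_space R I n = unital_tuples R n // proj_rel R I n"

text \<open>For \<open>I \<subseteq> J\<close>, the class modulo \<open>J\<close> containing a class \<open>C\<close> modulo \<open>I\<close> is the image
  of \<open>C\<close> under the coarser relation; see \<open>proj_reduction_class\<close> below.\<close>

definition proj_reduction ::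
    "('a, 'b) ring_scheme \<Rightarrow> 'a set \<Rightarrow> nat \<Rightarrow> (nat \<Rightarrow> 'a) set \<Rightarrow> (nat \<Rightarrow> 'a) set"
  where "proj_reduction R J n C = proj_rel R J n `` C"

definition crt_reduction ::
    "('a, 'b) ring_scheme \<Rightarrow> (nat \<Rightarrow> 'a set) \<Rightarrow> nat \<Rightarrow> nat \<Rightarrow>
      (nat \<Rightarrow> 'a) set \<Rightarrow> nat \<Rightarrow> (nat \<Rightarrow> 'a) set"
  where "crt_reduction R Q k n C = (\<lambda>i\<in>{1..k}. proj_reduction R (Q i) n C)"


lemma unital_tuples_closed: "a \<in> unital_tuples R n \<Longrightarrow> i \<le> n \<Longrightarrow> a i \<in> carrier R"
  unfolding unital_tuples_def by auto

context cring
begin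

lemma proj_rel_sym_all:
  assumes I: "ideal I R" and ab: "(a, b) \<in> proj_rel R I n" and ij: "i \<le> n" "j \<le> n"
  shows "a i \<otimes> b j \<ominus> a j \<otimes> b i \<in> I"
proof -
  interpret ideal I R by (rule I)
  have u: "a \<in> unital_tuples R n" "b \<in> unital_tuples R n"
    using ab by (auto simp: proj_rel_def)
  have c: "a i \<in> carrier R" "a j \<in> carrier R" "b i \<in> carrier R" "b j \<in> carrier R"
    using u ij by (auto intro: unital_tuples_closed)
  consider "i < j" | "i = j" | "j < i" by linarith
  then show ?thesis
  proof cases
    case 1 then show ?thesis using ab ij by (auto simp: proj_rel_def)
  next
    case 2
    have "a i \<otimes> b j \<ominus> a j \<otimes> b i = \<zero>" unfolding 2 using c by (simp add: 2) algebra
    then show ?thesis by simp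
  next
    case 3
    then have "a j \<otimes> b i \<ominus> a i \<otimes> b j \<in> I" using ab ij by (auto simp: proj_rel_def)
    then have "\<ominus> (a j \<otimes> b i \<ominus> a i \<otimes> b j) \<in> I" by (rule a_inv_closed)
    moreover have "\<ominus> (a j \<otimes> b i \<ominus> a i \<otimes> b j) = a i \<otimes> b j \<ominus> a j \<otimes> b i"
      using c by algebra
    ultimately show ?thesis by simp
  qed
qed

lemma proj_rel_trans:
  assumes I: "ideal I R" and ab: "(a, b) \<in> proj_rel R I n" and bc: "(b, c) \<in> proj_rel R I n"
  shows "(a, c) \<in> proj_rel R I n"
proof -
  interpret ideal I R by (rule I)
  have u: "a \<in> unital_tuples R n" "b \<in> unital_tuples R n" "c \<in> unital_tuples R n"
    using ab bc by (auto simp: proj_rel_def)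
  have "a i \<otimes> c j \<ominus> a j \<otimes> c i \<in> I" if ij: "i < j" "j \<le> n" for i j
  proof -
    define d where "d = a i \<otimes> c j \<ominus> a j \<otimes> c i"
    have car: "a m \<in> carrier R" "b m \<in> carrier R" "c m \<in> carrier R" if "m \<le> n" for m
      using u that by (auto intro: unital_tuples_closed)
    have ijn: "i \<le> n" "j \<le> n" using ij by auto
    note ci = car[OF ijn(1)] note cj = car[OF ijn(2)]
    have d: "d \<in> carrier R" using ci cj by (simp add: d_def)
    define J where "J = {x \<in> carrier R. x \<otimes> d \<in> I}"
    have "ideal J R"
    proof (rule idealI)
      show "ring R" by (rule ring_axioms)
      show "subgroup J (add_monoid R)"
      proof (rule add.subgroupI)
        show "J \<subseteq> carrier R" by (auto simp: J_def)
        have "\<zero> \<in> J" using d by (simp add: J_def)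
        then show "J \<noteq> {}" by blast
        show "\<ominus> x \<in> J" if "x \<in> J" for x
          using that d by (auto simp: J_def l_minus)
        show "x \<oplus> y \<in> J" if "x \<in> J" "y \<in> J" for x y
          using that d by (auto simp: J_def l_distr)
      qed
      show "x \<otimes> y \<in> J" if "y \<in> J" "x \<in> carrier R" for y x
        using that d by (auto simp: J_def m_assoc I_l_closed)
      show "y \<otimes> x \<in> J" if "y \<in> J" "x \<in> carrier R" for y x
        using that d by (auto simp: J_def m_assoc I_l_closed m_lcomm)
    qed
    moreover have "b ` {0..n} \<subseteq> J"
    proof
      fix y assume "y \<in> b ` {0..n}"
      then obtain m where m: "m \<le> n" "y = b m" by auto
      note cm = car[OF m(1)]
      have 1: "a i \<otimes> b m \<ominus> a m \<otimes> b i \<in> I" using proj_rel_sym_all[OF I ab] ijn m by auto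
      have 2: "b i \<otimes> c j \<ominus> b j \<otimes> c i \<in> I" using proj_rel_sym_all[OF I bc] ijn m by auto
      have 3: "a j \<otimes> b m \<ominus> a m \<otimes> b j \<in> I" using proj_rel_sym_all[OF I ab] ijn m by auto
      have "c j \<otimes> (a i \<otimes> b m \<ominus> a m \<otimes> b i) \<oplus> a m \<otimes> (b i \<otimes> c j \<ominus> b j \<otimes> c i)
          \<oplus> (\<ominus> (c i)) \<otimes> (a j \<otimes> b m \<ominus> a m \<otimes> b j) \<in> I"
        using 1 2 3 ci cj cm by (intro a_closed I_l_closed) auto
      moreover have "c j \<otimes> (a i \<otimes> b m \<ominus> a m \<otimes> b i) \<oplus> a m \<otimes> (b i \<otimes> c j \<ominus> b j \<otimes> c i)
          \<oplus> (\<ominus> (c i)) \<otimes> (a j \<otimes> b m \<ominus> a m \<otimes> b j) = b m \<otimes> d"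
        unfolding d_def using ci cj cm by algebra
      ultimately show "y \<in> J" using m cm by (simp add: J_def)
    qed
    ultimately have "Idl (b ` {0..n}) \<subseteq> J" by (rule genideal_minimal)
    then have "\<one> \<in> J" using u(2) by (auto simp: unital_tuples_def)
    then show ?thesis using d by (simp add: J_def d_def)
  qed
  then show ?thesis using u by (auto simp: proj_rel_def)
qed

lemma proj_rel_equiv:
  assumes I: "ideal I R"
  shows "equiv (unital_tuples R n) (proj_rel R I n)"
proof (rule equivI)
  interpret ideal I R by (rule I)
  show "proj_rel R I n \<subseteq> unital_tuples R n \<times> unital_tuples R n"
    by (auto simp: proj_rel_def)
  show "refl_on (unital_tuples R n) (proj_rel R I n)"
  proof (rule refl_onI)
    fix a assume a: "a \<in> unital_tuples R n"
    have "a i \<otimes> a j \<ominus> a j \<otimes> a i \<in> I" if "i < j" "j \<le> n" for i j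
    proof -
      have "a i \<in> carrier R" "a j \<in> carrier R"
        using a that by (auto intro: unital_tuples_closed)
      then have "a i \<otimes> a j \<ominus> a j \<otimes> a i = \<zero>" by algebra
      then show ?thesis by simp
    qed
    then show "(a, a) \<in> proj_rel R I n" using a by (auto simp: proj_rel_def)
  qed
  show "sym (proj_rel R I n)"
  proof (rule symI)
    fix a b assume ab: "(a, b) \<in> proj_rel R I n"
    have u: "a \<in> unital_tuples R n" "b \<in> unital_tuples R n"
      using ab by (auto simp: proj_rel_def)
    have "b i \<otimes> a j \<ominus> b j \<otimes> a i \<in> I" if "i < j" "j \<le> n" for i j
    proof -
      have c: "a i \<in> carrier R" "a j \<in> carrier R" "b i \<in> carrier R" "b j \<in> carrier R"
        using u that by (auto intro: unital_tuples_closed)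
      have "a j \<otimes> b i \<ominus> a i \<otimes> b j \<in> I" using proj_rel_sym_all[OF I ab] that by auto
      then show ?thesis using c by (simp add: m_comm)
    qed
    then show "(b, a) \<in> proj_rel R I n" using u by (auto simp: proj_rel_def)
  qed
  show "trans (proj_rel R I n)"
    using proj_rel_trans[OF I] by (auto intro: transI)
qed

lemma proj_reduction_class:
  assumes I: "ideal I R" and J: "ideal J R" and sub: "I \<subseteq> J" and a: "a \<in> unital_tuples R n"
  shows "proj_reduction R J n (proj_rel R I n `` {a}) = proj_rel R J n `` {a}"
proof -
  have 1: "(a, a) \<in> proj_rel R I n"
    using proj_rel_equiv[OF I] a by (auto simp: equiv_def refl_on_def)
  have 2: "(a, b) \<in> proj_rel R J n" if "(a, b) \<in> proj_rel R I n" for b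
    using that sub by (auto simp: proj_rel_def)
  show ?thesis
    unfolding proj_reduction_def using 1 2 proj_rel_trans[OF J] by blast
qed

lemma comaximal_pow:
  assumes x: "x \<in> carrier R" and y: "y \<in> carrier R" and xy: "x \<oplus> y = \<one>"
  shows "\<exists>r\<in>carrier R. \<exists>s\<in>carrier R. r \<otimes> x [^] (t::nat) \<oplus> s \<otimes> y = \<one>"
proof (induction t)
  case 0
  show ?case using x y by (intro bexI[of _ \<one>] bexI[of _ \<zero>]) auto
next
  case (Suc t)
  then obtain r s where rs: "r \<in> carrier R" "s \<in> carrier R"
    and e: "r \<otimes> x [^] t \<oplus> s \<otimes> y = \<one>" by blast
  define p where "p = x [^] t"
  have p: "p \<in> carrier R" using x by (simp add: p_def)
  have "r \<otimes> (p \<otimes> x) \<oplus> (r \<otimes> p \<oplus> s) \<otimes> y = r \<otimes> p \<otimes> (x \<oplus> y) \<oplus> s \<otimes> y"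
    using rs p x y by algebra
  also have "\<dots> = \<one>" using e rs p by (simp add: xy p_def)
  finally have "r \<otimes> x [^] Suc t \<oplus> (r \<otimes> p \<oplus> s) \<otimes> y = \<one>"
    by (simp add: p_def)
  then show ?case using rs p by (intro bexI[of _ r] bexI[of _ "r \<otimes> p \<oplus> s"]) auto
qed

lemma comaximal_of_radicals:
  assumes P: "ideal P R" and Q: "ideal Q R"
    and mP: "maximalideal (ideal_radical R P) R" and mQ: "maximalideal (ideal_radical R Q) R"
    and ne: "ideal_radical R P \<noteq> ideal_radical R Q"
  shows "P <+> Q = carrier R"
proof -
  let ?M = "ideal_radical R P" and ?N = "ideal_radical R Q"
  interpret M: maximalideal ?M R by (rule mP)
  interpret N: maximalideal ?N R by (rule mQ)
  interpret P: ideal P R by (rule P)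
  interpret Q: ideal Q R by (rule Q)
  have id: "ideal (?M <+> ?N) R" by (rule add_ideals[OF M.ideal_axioms N.ideal_axioms])
  interpret S: ideal "set_add R ?M ?N" R by (rule id)
  have sub: "?M <+> ?N \<subseteq> carrier R" using S.a_subset .
  have l: "?M \<subseteq> ?M <+> ?N"
  proof
    fix x assume x: "x \<in> ?M"
    then have "x = x \<oplus> \<zero>" using M.Icarr by simp
    then show "x \<in> ?M <+> ?N" using x N.zero_closed unfolding set_add_def' by blast
  qed
  have r: "?N \<subseteq> ?M <+> ?N"
  proof
    fix x assume x: "x \<in> ?N"
    then have "x = \<zero> \<oplus> x" using N.Icarr by simp
    then show "x \<in> ?M <+> ?N" using x M.zero_closed unfolding set_add_def' by blast
  qed
  have "?M <+> ?N = carrier R"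
  proof (rule ccontr)
    assume "?M <+> ?N \<noteq> carrier R"
    then have "?M <+> ?N = ?M" "?M <+> ?N = ?N"
      using M.I_maximal[OF id l sub] N.I_maximal[OF id r sub] by auto
    with ne show False by simp
  qed
  then have "\<one> \<in> ?M <+> ?N" by simp
  then obtain x y where xy: "x \<in> ?M" "y \<in> ?N" "x \<oplus> y = \<one>"
    unfolding set_add_def' by auto
  have c: "x \<in> carrier R" "y \<in> carrier R" using xy M.Icarr N.Icarr by auto
  obtain s :: nat where s: "x [^] s \<in> P"
    using xy(1) unfolding ideal_radical_def by blast
  obtain t :: nat where t: "y [^] t \<in> Q"
    using xy(2) unfolding ideal_radical_def by blast
  obtain u v where uv: "u \<in> carrier R" "v \<in> carrier R" "u \<otimes> x [^] s \<oplus> v \<otimes> y = \<one>"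
    using comaximal_pow[OF c xy(3)] by blast
  have "v \<otimes> y \<oplus> u \<otimes> x [^] s = \<one>" using uv c by (simp add: a_comm)
  then obtain u' v' where uv': "u' \<in> carrier R" "v' \<in> carrier R"
      "u' \<otimes> (v \<otimes> y) [^] t \<oplus> v' \<otimes> (u \<otimes> x [^] s) = \<one>"
    using comaximal_pow[of "v \<otimes> y" "u \<otimes> x [^] s" t] uv(1,2) c by blast
  have "u' \<otimes> (v \<otimes> y) [^] t \<in> Q"
    using uv uv' c t by (simp add: nat_pow_distrib Q.I_l_closed)
  moreover have "v' \<otimes> (u \<otimes> x [^] s) \<in> P"
    using uv uv' s by (simp add: P.I_l_closed)
  moreover have "v' \<otimes> (u \<otimes> x [^] s) \<oplus> u' \<otimes> (v \<otimes> y) [^] t = \<one>"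
    using uv uv' c by (simp add: a_comm)
  ultimately have one: "\<one> \<in> P <+> Q" unfolding set_add_def' by fastforce
  interpret T: ideal "set_add R P Q" R by (rule add_ideals[OF P Q])
  show ?thesis using T.one_imp_carrier[OF one] .
qed

lemma ideal_product_eq_Inter:
  assumes "\<And>i. i \<in> {1..k::nat} \<Longrightarrow> ideal (Q i) R"
    and "\<And>i. i \<in> {1..k} \<Longrightarrow> maximalideal (ideal_radical R (Q i)) R"
    and "inj_on (\<lambda>i. ideal_radical R (Q i)) {1..k}"
  shows "(\<Otimes>\<^bsub>ideals_set R\<^esub> i\<in>{1..k}. Q i) = carrier R \<inter> (\<Inter>i\<in>{1..k}. Q i)"
proof (cases k)
  case 0
  then show ?thesis
    by (simp add: comm_monoid.finprod_empty[OF ideals_set_is_comm_monoid])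
       (simp add: ideals_set_def)
next
  case (Suc m)
  interpret L: comm_monoid "ideals_set R" by (rule ideals_set_is_comm_monoid)
  have img: "{1..k} = Suc ` {..m}"
    by (simp add: Suc image_Suc_atMost)
  have comax: "Q i <+> Q j = carrier R" if "i \<in> {1..k}" "j \<in> {1..k}" "i \<noteq> j" for i j
    using assms that by (intro comaximal_of_radicals) (auto dest: inj_onD)
  have "(\<Otimes>\<^bsub>ideals_set R\<^esub> i\<in>{1..k}. Q i) = (\<Otimes>\<^bsub>ideals_set R\<^esub> i\<in>{..m}. Q (Suc i))"
    unfolding img by (rule L.finprod_reindex) (use assms(1) Suc in \<open>auto simp: ideals_set_def\<close>)
  also have "\<dots> = (\<Inter>i\<in>{..m}. Q (Suc i))"
  proof (rule ideal_prod_eq_Inter)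
    show "(\<lambda>i. Q (Suc i)) \<in> {..m} \<rightarrow> {J. ideal J R}" using assms(1) Suc by auto
    show "Q (Suc i) <+> Q (Suc j) = carrier R" if "i \<in> {..m}" "j \<in> {..m}" "i \<noteq> j" for i j
      using comax[of "Suc i" "Suc j"] that Suc by auto
  qed
  also have "\<dots> = (\<Inter>i\<in>{1..k}. Q i)" unfolding img by simp
  also have "\<dots> = carrier R \<inter> (\<Inter>i\<in>{1..k}. Q i)"
  proof -
    have "Q 1 \<subseteq> carrier R"
      using assms(1)[of 1] Suc by (auto simp: ideal.Icarr)
    then show ?thesis using Suc by force
  qed
  finally show ?thesis .
qed

lemma ideal_product_in_intrad:
  assumes "\<And>i. i \<in> {1..k::nat} \<Longrightarrow> ideal (Q i) R"
    and "\<And>i. i \<in> {1..k} \<Longrightarrow> maximalideal (ideal_radical R (Q i)) R"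
    and "inj_on (\<lambda>i. ideal_radical R (Q i)) {1..k}"
    and "(\<Otimes>\<^bsub>ideals_set R\<^esub> i\<in>{1..k}. Q i) \<noteq> {\<zero>}"
  shows "(\<Otimes>\<^bsub>ideals_set R\<^esub> i\<in>{1..k}. Q i) \<in> intrad R"
proof -
  interpret L: comm_monoid "ideals_set R" by (rule ideals_set_is_comm_monoid)
  have "(\<Otimes>\<^bsub>ideals_set R\<^esub> i\<in>{1..k}. Q i) \<in> carrier (ideals_set R)"
    by (rule L.finprod_closed) (use assms(1) in \<open>auto simp: ideals_set_def\<close>)
  then have id: "ideal (\<Otimes>\<^bsub>ideals_set R\<^esub> i\<in>{1..k}. Q i) R" by (simp add: ideals_set_def)
  have inj: "inj_on (ideal_radical R) (Q ` {1..k})"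
    using assms(3) by (intro inj_on_imageI) (simp add: o_def)
  have "\<forall>P\<in>Q ` {1..k}. ideal P R \<and> maximalideal (ideal_radical R P) R"
    using assms(1,2) by auto
  with inj ideal_product_eq_Inter[OF assms(1-3)]
  have "\<exists>F. (\<forall>P\<in>F. ideal P R \<and> maximalideal (ideal_radical R P) R) \<and>
      inj_on (ideal_radical R) F \<and>
      (\<Otimes>\<^bsub>ideals_set R\<^esub> i\<in>{1..k}. Q i) = carrier R \<inter> \<Inter>F"
    by (intro exI[of _ "Q ` {1..k}"] conjI)
  with id assms(4) show ?thesis unfolding intrad_def by simp
qed

lemma ideal_in_intrad:
  assumes "ideal Q R" "maximalideal (ideal_radical R Q) R" "Q \<noteq> {\<zero>}"
  shows "Q \<in> intrad R"
proof -
  have "Q \<subseteq> carrier R" using assms(1) by (auto simp: ideal.Icarr)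
  then show ?thesis unfolding intrad_def
    using assms by (auto intro!: exI[of _ "{Q}"])
qed

lemma crt_reduction_class:
  assumes "\<And>i. i \<in> {1..k::nat} \<Longrightarrow> ideal (Q i) R"
    and "\<And>i. i \<in> {1..k} \<Longrightarrow> maximalideal (ideal_radical R (Q i)) R"
    and "inj_on (\<lambda>i. ideal_radical R (Q i)) {1..k}"
    and I: "I = (\<Otimes>\<^bsub>ideals_set R\<^esub> i\<in>{1..k}. Q i)"
    and a: "a \<in> unital_tuples R n"
  shows "crt_reduction R Q k n (proj_rel R I n `` {a}) = (\<lambda>i\<in>{1..k}. proj_rel R (Q i) n `` {a})"
proof -
  interpret L: comm_monoid "ideals_set R" by (rule ideals_set_is_comm_monoid)
  have "I \<in> carrier (ideals_set R)"
    unfolding I by (rule L.finprod_closed) (use assms(1) in \<open>auto simp: ideals_set_def\<close>)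
  then have id: "ideal I R" by (simp add: ideals_set_def)
  have sub: "I \<subseteq> Q i" if "i \<in> {1..k}" for i
    using ideal_product_eq_Inter[OF assms(1-3)] that I by blast
  show ?thesis
    unfolding crt_reduction_def
    by (rule restrict_ext) (use proj_reduction_class[OF id assms(1) sub a] in blast)
qed

end

end

(* Modulo Q_i the ring is local, so a unital tuple a can be rescaled by some v with either
   v a_0 = 1 or v (a_0 + a_j) = 1 modulo Q_i for some j \<ge> 1. Choose b_1, ..., b_n by the Chinese
   remainder theorem, congruent to the rescaled entries, and J the ideal they generate. Applying
   the Chinese remainder theorem inside J gives z in J, congruent to 0 or b_j modulo each Q_i
   according to the case; then b_0 = 1 - z has the prescribed residues and (b_0, ..., b_n) is
   unital. *)

theory Submission
  imports Defs
begin

context cring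
begin

section \<open>Chinese remaindering with solutions confined to an ideal\<close>

text \<open>Each \<open>Q j\<close> contains an element congruent to 1 modulo \<open>P\<close>, and
  the product of these over \<open>S\<close> works. The resulting \<open>e\<close> is 1 at one place
  and 0 at the others, the building block for interpolation.\<close>

lemma comaximal_finite_family:
  assumes P: "ideal P R" and "finite S"
    and "\<And>j. j \<in> S \<Longrightarrow> ideal (Q j) R" and "\<And>j. j \<in> S \<Longrightarrow> P <+> Q j = carrier R"
  shows "\<exists>e\<in>carrier R. e \<ominus> \<one> \<in> P \<and> (\<forall>j\<in>S. e \<in> Q j)"
  using assms(2-)
proof (induction S rule: finite_induct)
  case empty
  interpret P: ideal P R by (rule P)
  have "\<one> \<ominus> \<one> = \<zero>" by (simp add: minus_eq r_neg)
  then show ?case by (intro bexI[of _ \<one>]) auto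
next
  case (insert s S)
  interpret P: ideal P R by (rule P)
  interpret Qs: ideal "Q s" R by (rule insert.prems) simp
  obtain e where e: "e \<in> carrier R" "e \<ominus> \<one> \<in> P" "\<forall>j\<in>S. e \<in> Q j"
    using insert by auto
  have "\<one> \<in> P <+> Q s" using insert.prems(2)[of s] by simp
  then obtain p f where pf: "p \<in> P" "f \<in> Q s" "p \<oplus> f = \<one>"
    unfolding set_add_def' by auto
  have c: "p \<in> carrier R" "f \<in> carrier R" using pf P.Icarr Qs.Icarr by auto
  \<comment> \<open>Since \<open>p \<oplus> f = \<one>\<close>, multiplying \<open>e\<close> by
    \<open>f\<close> changes it only by the multiple \<open>e \<otimes> p\<close> of
    \<open>p\<close>, which lies in \<open>P\<close>.\<close>
  have "e \<otimes> f \<ominus> \<one> = e \<otimes> (p \<oplus> f) \<ominus> \<one> \<ominus> e \<otimes> p" using c e(1) by algebra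
  also have "\<dots> = (e \<ominus> \<one>) \<oplus> \<ominus> (e \<otimes> p)" using c e(1) pf(3) by (simp add: minus_eq)
  also have "\<dots> \<in> P" using e pf by (simp add: P.I_l_closed)
  finally have "e \<otimes> f \<ominus> \<one> \<in> P" .
  moreover have "e \<otimes> f \<in> Q j" if "j \<in> insert s S" for j
  proof (cases "j = s")
    case True then show ?thesis using pf e by (simp add: Qs.I_l_closed)
  next
    case False
    then have "e \<in> Q j" using e that by auto
    then show ?thesis using ideal.I_r_closed[OF insert.prems(1)[OF that]] c by auto
  qed
  ultimately show ?case using e c by (intro bexI[of _ "e \<otimes> f"]) auto
qed

text \<open>Every correction made in the induction is a multiple of a difference of elements of
  \<open>J\<close>, so the solution never leaves \<open>J\<close>. For \<open>J\<close> the whole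
  ring this is the usual Chinese remainder theorem; proper \<open>J\<close> serves to keep a tuple
  unital later.\<close>

lemma chinese_remainder_in_ideal:
  assumes J: "ideal J R" and "finite S"
    and "\<And>i. i \<in> S \<Longrightarrow> ideal (Q i) R"
    and "\<And>i j. i \<in> S \<Longrightarrow> j \<in> S \<Longrightarrow> i \<noteq> j \<Longrightarrow> Q i <+> Q j = carrier R"
    and "\<And>i. i \<in> S \<Longrightarrow> f i \<in> J"
  shows "\<exists>x\<in>J. \<forall>i\<in>S. x \<ominus> f i \<in> Q i"
  using assms(2-)
proof (induction S rule: finite_induct)
  case empty
  then show ?case using additive_subgroup.zero_closed[OF ideal.axioms(1)[OF J]] by auto
next
  case (insert s S)
  interpret J: ideal J R by (rule J)
  have idQ: "ideal (Q i) R" if "i \<in> insert s S" for i using insert.prems(1) that .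
  have fJ: "f i \<in> J" if "i \<in> insert s S" for i using insert.prems(3) that .
  obtain x where x: "x \<in> J" "\<forall>i\<in>S. x \<ominus> f i \<in> Q i"
    using insert by blast
  have "\<exists>e\<in>carrier R. e \<ominus> \<one> \<in> Q s \<and> (\<forall>j\<in>S. e \<in> Q j)"
    using insert.hyps insert.prems by (intro comaximal_finite_family) auto
  then obtain e where e: "e \<in> carrier R" "e \<ominus> \<one> \<in> Q s" "\<forall>j\<in>S. e \<in> Q j" by blast
  have c: "x \<in> carrier R" "\<And>i. i \<in> insert s S \<Longrightarrow> f i \<in> carrier R"
    using x fJ J.Icarr by auto
  \<comment> \<open>Modulo \<open>Q s\<close> the factor \<open>e\<close> is 1, which turns
    \<open>x\<close> into \<open>f s\<close>; modulo the earlier ideals it is 0, which keeps the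
    residues of \<open>x\<close>.\<close>
  define y where "y = x \<oplus> e \<otimes> (f s \<ominus> x)"
  have "f s \<ominus> x \<in> J" using x fJ[of s] by (simp add: minus_eq)
  then have y: "y \<in> J" using x e by (simp add: y_def J.I_l_closed)
  have "y \<ominus> f i \<in> Q i" if i: "i \<in> insert s S" for i
  proof -
    interpret Qi: ideal "Q i" R by (rule idQ[OF i])
    have fs: "f s \<in> carrier R" and fi: "f i \<in> carrier R" using c(2) i by auto
    show ?thesis
    proof (cases "i = s")
      case True
      have "y \<ominus> f s = (e \<ominus> \<one>) \<otimes> (f s \<ominus> x)"
        unfolding y_def using e(1) c(1) fs by algebra
      moreover have "e \<ominus> \<one> \<in> Q i" using e(2) True by simp
      ultimately show ?thesis using True c(1) fs Qi.I_r_closed[of "e \<ominus> \<one>" "f s \<ominus> x"] by simp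
    next
      case False
      then have "x \<ominus> f i \<in> Q i" "e \<otimes> (f s \<ominus> x) \<in> Q i"
        using x(2) e(3) i c(1) fs by (auto intro: Qi.I_r_closed)
      moreover have "y \<ominus> f i = (x \<ominus> f i) \<oplus> e \<otimes> (f s \<ominus> x)"
        unfolding y_def using e(1) c(1) fs fi by algebra
      ultimately show ?thesis by simp
    qed
  qed
  then show ?case using y by blast
qed

section \<open>Units modulo an ideal with maximal radical, and rescaling of unital tuples\<close>

text \<open>The quotient by \<open>Q\<close> is local: its only maximal ideal comes from the
  radical. Maximality gives \<open>m \<oplus> d \<otimes> c = \<one>\<close> with \<open>m\<close>
  in the radical, and passing to a power of \<open>m\<close> that lies in \<open>Q\<close> makes
  \<open>c\<close> invertible modulo \<open>Q\<close>.\<close>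

lemma unit_mod_primary:
  assumes Q: "ideal Q R" and M: "maximalideal (ideal_radical R Q) R"
    and c: "c \<in> carrier R" "c \<notin> ideal_radical R Q"
  shows "\<exists>v\<in>carrier R. v \<otimes> c \<ominus> \<one> \<in> Q"
proof -
  let ?M = "ideal_radical R Q"
  interpret Q: ideal Q R by (rule Q)
  interpret M: maximalideal ?M R by (rule M)
  have C: "ideal (PIdl c) R" using c(1) by (rule cgenideal_ideal)
  interpret C: ideal "PIdl c" R by (rule C)
  have S: "ideal (?M <+> PIdl c) R" by (rule add_ideals[OF M.ideal_axioms C])
  interpret S: ideal "set_add R ?M (PIdl c)" R by (rule S)
  have "?M \<subseteq> ?M <+> PIdl c"
  proof
    fix x assume x: "x \<in> ?M"
    then have "x = x \<oplus> \<zero>" using M.Icarr by simp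
    then show "x \<in> ?M <+> PIdl c" using x C.zero_closed unfolding set_add_def' by blast
  qed
  moreover have "c \<in> ?M <+> PIdl c"
  proof -
    have "c = \<zero> \<oplus> c" using c by simp
    then show ?thesis
      using M.zero_closed cgenideal_self[OF c(1)] unfolding set_add_def' by blast
  qed
  ultimately have "?M <+> PIdl c = carrier R"
    using M.I_maximal[OF S _ S.a_subset] c(2) by auto
  then have "\<one> \<in> ?M <+> PIdl c" by simp
  then obtain m d where m: "m \<in> ?M" and d: "d \<in> carrier R" and md: "m \<oplus> d \<otimes> c = \<one>"
    unfolding set_add_def' cgenideal_def by auto
  have mc: "m \<in> carrier R" using m M.Icarr by auto
  obtain s :: nat where s: "m [^] s \<in> Q"
    using m unfolding ideal_radical_def by blast
  obtain u w where uw: "u \<in> carrier R" "w \<in> carrier R" "u \<otimes> m [^] s \<oplus> w \<otimes> (d \<otimes> c) = \<one>"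
    using comaximal_pow[OF mc _ md] d c(1) by blast
  define q where "q = u \<otimes> m [^] s"
  have q: "q \<in> Q" "q \<in> carrier R" using s uw mc by (auto simp: q_def Q.I_l_closed)
  \<comment> \<open>The inverse of \<open>c\<close> modulo \<open>Q\<close> is
    \<open>w \<otimes> d\<close>, with error \<open>q\<close> in \<open>Q\<close>.\<close>
  have "(w \<otimes> d) \<otimes> c \<ominus> (q \<oplus> w \<otimes> (d \<otimes> c)) = \<ominus> q"
    using q(2) uw(2) d c(1) by algebra
  then have "(w \<otimes> d) \<otimes> c \<ominus> \<one> \<in> Q" using q uw(3) by (simp add: q_def[symmetric])
  then show ?thesis using uw d by blast
qed

text \<open>If \<open>a 0\<close> is in the radical, some other entry \<open>a j\<close> is not, and
  then neither is \<open>a 0 \<oplus> a j\<close>. Inverting this sum rather than \<open>a j\<close>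
  yields \<open>v \<otimes> a 0\<close> congruent to
  \<open>\<one> \<ominus> v \<otimes> a j\<close>, so the rescaled entry 0 is 1 minus another
  rescaled entry.\<close>

lemma unital_rescale_mod_primary:
  assumes Q: "ideal Q R" and M: "maximalideal (ideal_radical R Q) R"
    and a: "a \<in> unital_tuples R n"
  shows "\<exists>v\<in>carrier R. v \<otimes> a 0 \<ominus> \<one> \<in> Q \<or> (\<exists>j\<in>{1..n}. v \<otimes> (a 0 \<oplus> a j) \<ominus> \<one> \<in> Q)"
proof (cases "a 0 \<in> ideal_radical R Q")
  case False
  then show ?thesis
    using unit_mod_primary[OF Q M] unital_tuples_closed[OF a, of 0] by blast
next
  case True
  let ?M = "ideal_radical R Q"
  interpret M: maximalideal ?M R by (rule M)
  \<comment> \<open>The entries generate the whole ring, so they cannot all lie in a proper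
    ideal.\<close>
  have "\<not> a ` {0..n} \<subseteq> ?M"
  proof
    assume "a ` {0..n} \<subseteq> ?M"
    then have "Idl (a ` {0..n}) \<subseteq> ?M" by (rule genideal_minimal[OF M.ideal_axioms])
    then show False using a M.I_notcarr M.a_subset by (auto simp: unital_tuples_def)
  qed
  then obtain j where j: "j \<le> n" "a j \<notin> ?M"
    by (auto simp: image_subset_iff)
  with True have j1: "j \<in> {1..n}" by (cases "j = 0") auto
  have c: "a 0 \<in> carrier R" "a j \<in> carrier R"
    using unital_tuples_closed[OF a] j by auto
  have "a 0 \<oplus> a j \<notin> ?M"
  proof
    assume "a 0 \<oplus> a j \<in> ?M"
    then have "\<ominus> a 0 \<oplus> (a 0 \<oplus> a j) \<in> ?M" using True by simp
    then show False using c j(2) by (simp add: a_assoc[symmetric] l_neg)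
  qed
  then show ?thesis using unit_mod_primary[OF Q M] c j1 by blast
qed

text \<open>In the cross difference of \<open>a\<close> and \<open>b\<close> the two terms
  containing \<open>v\<close> cancel by commutativity, leaving a combination of the errors
  \<open>b j \<ominus> v \<otimes> a j\<close>.\<close>

lemma proj_rel_of_rescale:
  assumes Q: "ideal Q R" and a: "a \<in> unital_tuples R n" and b: "b \<in> unital_tuples R n"
    and v: "v \<in> carrier R" and ba: "\<And>j. j \<le> n \<Longrightarrow> b j \<ominus> v \<otimes> a j \<in> Q"
  shows "(a, b) \<in> proj_rel R Q n"
proof -
  interpret Q: ideal Q R by (rule Q)
  have "a i \<otimes> b j \<ominus> a j \<otimes> b i \<in> Q" if "i < j" "j \<le> n" for i j
  proof -
    have c: "a i \<in> carrier R" "a j \<in> carrier R" "b i \<in> carrier R" "b j \<in> carrier R"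
      using a b that by (auto intro: unital_tuples_closed)
    have "a i \<otimes> (b j \<ominus> v \<otimes> a j) \<oplus> (\<ominus> a j) \<otimes> (b i \<ominus> v \<otimes> a i) \<in> Q"
      using ba that c by (intro Q.a_closed Q.I_l_closed) auto
    moreover have "a i \<otimes> (b j \<ominus> v \<otimes> a j) \<oplus> (\<ominus> a j) \<otimes> (b i \<ominus> v \<otimes> a i)
        = a i \<otimes> b j \<ominus> a j \<otimes> b i"
      using c v by algebra
    ultimately show ?thesis by simp
  qed
  then show ?thesis using a b by (auto simp: proj_rel_def)
qed

section \<open>Lifting local tuples to one unital tuple\<close>

text \<open>This is surjectivity on representatives. Entrywise Chinese remaindering alone controls
  the entries only modulo the \<open>Q i\<close>, whereas \<open>b\<close> has to generate
  \<open>R\<close> itself; the freedom left in entry 0 is spent on that.\<close>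

lemma unital_chinese_remainder:
  assumes fin: "finite S"
    and Q: "\<And>i. i \<in> S \<Longrightarrow> ideal (Q i) R"
    and M: "\<And>i. i \<in> S \<Longrightarrow> maximalideal (ideal_radical R (Q i)) R"
    and inj: "inj_on (\<lambda>i. ideal_radical R (Q i)) S"
    and a: "\<And>i. i \<in> S \<Longrightarrow> a i \<in> unital_tuples R n"
  shows "\<exists>b\<in>unital_tuples R n. \<forall>i\<in>S. (a i, b) \<in> proj_rel R (Q i) n"
proof -
  have comax: "Q i <+> Q j = carrier R" if "i \<in> S" "j \<in> S" "i \<noteq> j" for i j
    using Q M inj that by (intro comaximal_of_radicals) (auto dest: inj_onD)
  have ac: "a i j \<in> carrier R" if "i \<in> S" "j \<le> n" for i j
    using a that by (auto intro: unital_tuples_closed)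
  have "\<forall>i\<in>S. \<exists>v. v \<in> carrier R \<and> (v \<otimes> a i 0 \<ominus> \<one> \<in> Q i \<or>
      (\<exists>j\<in>{1..n}. v \<otimes> (a i 0 \<oplus> a i j) \<ominus> \<one> \<in> Q i))"
    using unital_rescale_mod_primary[OF Q M a] by blast
  then obtain v where v: "\<And>i. i \<in> S \<Longrightarrow> v i \<in> carrier R"
    and va: "\<And>i. i \<in> S \<Longrightarrow> v i \<otimes> a i 0 \<ominus> \<one> \<in> Q i \<or>
      (\<exists>j\<in>{1..n}. v i \<otimes> (a i 0 \<oplus> a i j) \<ominus> \<one> \<in> Q i)"
    using bchoice[of S] by metis
  \<comment> \<open>Only the entries from 1 on are fixed here, by Chinese remaindering in the unit
    ideal; entry 0 waits until the ideal they generate is known.\<close>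
  have "\<forall>j\<in>{1..n}. \<exists>x. x \<in> carrier R \<and> (\<forall>i\<in>S. x \<ominus> v i \<otimes> a i j \<in> Q i)"
  proof
    fix j assume "j \<in> {1..n}"
    then show "\<exists>x. x \<in> carrier R \<and> (\<forall>i\<in>S. x \<ominus> v i \<otimes> a i j \<in> Q i)"
      using chinese_remainder_in_ideal[OF oneideal fin, of Q "\<lambda>i. v i \<otimes> a i j"] Q comax ac v
      by auto
  qed
  then obtain c where c: "\<And>j. j \<in> {1..n} \<Longrightarrow> c j \<in> carrier R"
    and ca: "\<And>i j. i \<in> S \<Longrightarrow> j \<in> {1..n} \<Longrightarrow> c j \<ominus> v i \<otimes> a i j \<in> Q i"
    using bchoice[of "{1..n}"] by metis
  define J where "J = Idl (c ` {1..n})"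
  have sub: "c ` {1..n} \<subseteq> carrier R" using c by auto
  have J: "ideal J R" unfolding J_def by (rule genideal_ideal[OF sub])
  interpret J: ideal J R by (rule J)
  have cJ: "c j \<in> J" if "j \<in> {1..n}" for j
    using genideal_self[OF sub] that unfolding J_def by auto
  \<comment> \<open>Entry 0 must be congruent to \<open>v i \<otimes> a i 0\<close>. The residue of
    1 minus this entry has a representative in \<open>J\<close>: \<open>\<zero>\<close> when
    \<open>a i 0\<close> was inverted, \<open>c j\<close> when \<open>a i 0 \<oplus> a i j\<close>
    was.\<close>
  have "\<exists>z. z \<in> J \<and> \<one> \<ominus> z \<ominus> v i \<otimes> a i 0 \<in> Q i" if i: "i \<in> S" for i
  proof -
    interpret Qi: ideal "Q i" R by (rule Q[OF i])
    note vi = v[OF i] and a0 = ac[OF i, of 0, simplified]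
    consider "v i \<otimes> a i 0 \<ominus> \<one> \<in> Q i"
      | j where "j \<in> {1..n}" "v i \<otimes> (a i 0 \<oplus> a i j) \<ominus> \<one> \<in> Q i"
      using va[OF i] by blast
    then show ?thesis
    proof cases
      case 1
      then have "\<ominus> (v i \<otimes> a i 0 \<ominus> \<one>) \<in> Q i" by simp
      moreover have "\<ominus> (v i \<otimes> a i 0 \<ominus> \<one>) = \<one> \<ominus> \<zero> \<ominus> v i \<otimes> a i 0"
        using vi a0 by algebra
      ultimately show ?thesis using J.zero_closed by (intro exI[of _ \<zero>]) simp
    next
      case 2
      have aj: "a i j \<in> carrier R" using ac[OF i] 2 by auto
      have "\<ominus> (v i \<otimes> (a i 0 \<oplus> a i j) \<ominus> \<one>) \<oplus> \<ominus> (c j \<ominus> v i \<otimes> a i j) \<in> Q i"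
        using 2 ca[OF i 2(1)] by (intro Qi.a_closed Qi.a_inv_closed)
      moreover have "\<ominus> (v i \<otimes> (a i 0 \<oplus> a i j) \<ominus> \<one>) \<oplus> \<ominus> (c j \<ominus> v i \<otimes> a i j)
          = \<one> \<ominus> c j \<ominus> v i \<otimes> a i 0"
        using vi a0 aj c[OF 2(1)] by algebra
      ultimately show ?thesis using cJ 2 by auto
    qed
  qed
  then have "\<exists>z. \<forall>i\<in>S. z i \<in> J \<and> \<one> \<ominus> z i \<ominus> v i \<otimes> a i 0 \<in> Q i"
    by (intro bchoice) blast
  then obtain z where z: "\<And>i. i \<in> S \<Longrightarrow> z i \<in> J"
    and za: "\<And>i. i \<in> S \<Longrightarrow> \<one> \<ominus> z i \<ominus> v i \<otimes> a i 0 \<in> Q i"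
    by blast
  \<comment> \<open>The local choices \<open>z i\<close> are glued inside \<open>J\<close>, not
    merely inside \<open>R\<close>.\<close>
  have "\<exists>y\<in>J. \<forall>i\<in>S. y \<ominus> z i \<in> Q i"
    by (rule chinese_remainder_in_ideal[OF J fin]) (fact Q comax z)+
  then obtain y where y: "y \<in> J" and yz: "\<And>i. i \<in> S \<Longrightarrow> y \<ominus> z i \<in> Q i" by blast
  have yc: "y \<in> carrier R" using y J.Icarr by auto
  define b where "b = (\<lambda>j\<in>{0..n}. if j = 0 then \<one> \<ominus> y else c j)"
  have bc: "b \<in> {0..n} \<rightarrow>\<^sub>E carrier R" using c yc by (auto simp: b_def)
  then have bsub: "b ` {0..n} \<subseteq> carrier R" by auto
  interpret B: ideal "Idl (b ` {0..n})" R by (rule genideal_ideal[OF bsub])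
  have bB: "b j \<in> Idl (b ` {0..n})" if "j \<le> n" for j
    using genideal_self[OF bsub] that by auto
  have "c j \<in> Idl (b ` {0..n})" if "j \<in> {1..n}" for j
    using bB[of j] that by (simp add: b_def)
  \<comment> \<open>\<open>y\<close> is a combination of the later entries and entry 0 is
    \<open>\<one> \<ominus> y\<close>, so the ideal of all entries contains 1.\<close>
  then have "J \<subseteq> Idl (b ` {0..n})"
    unfolding J_def by (intro genideal_minimal B.ideal_axioms) auto
  then have "b 0 \<oplus> y \<in> Idl (b ` {0..n})" using y bB[of 0] by auto
  moreover have "b 0 \<oplus> y = \<one>" using yc by (simp add: b_def minus_eq a_assoc l_neg)
  ultimately have bu: "b \<in> unital_tuples R n"
    using bc B.one_imp_carrier by (simp add: unital_tuples_def)
  have "(a i, b) \<in> proj_rel R (Q i) n" if i: "i \<in> S" for i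
  proof (rule proj_rel_of_rescale[OF Q[OF i] a[OF i] bu v[OF i]])
    interpret Qi: ideal "Q i" R by (rule Q[OF i])
    fix j assume j: "j \<le> n"
    show "b j \<ominus> v i \<otimes> a i j \<in> Q i"
    proof (cases "j = 0")
      case False
      then show ?thesis using ca[OF i, of j] j by (simp add: b_def)
    next
      case True
      have zc: "z i \<in> carrier R" using z[OF i] J.Icarr by auto
      have "(\<one> \<ominus> z i \<ominus> v i \<otimes> a i 0) \<oplus> \<ominus> (y \<ominus> z i) \<in> Q i"
        using za[OF i] yz[OF i] by (intro Qi.a_closed Qi.a_inv_closed)
      moreover have "(\<one> \<ominus> z i \<ominus> v i \<otimes> a i 0) \<oplus> \<ominus> (y \<ominus> z i) = \<one> \<ominus> y \<ominus> v i \<otimes> a i 0"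
        using v[OF i] ac[OF i, of 0, simplified] zc yc by algebra
      ultimately show ?thesis using True by (simp add: b_def)
    qed
  qed
  then show ?thesis using bu by blast
qed

end

section \<open>Passage from tuples to projective classes\<close>

theorem mainTheorem1:
  fixes R :: "('a, 'b) ring_scheme" (structure)
    and l k :: nat
    and Q M :: "nat \<Rightarrow> 'a set"
    and I :: "'a set"
  assumes "cring R"
    and "\<And>i. i \<in> {1..k} \<Longrightarrow> ideal (Q i) R"
    and "\<And>i. i \<in> {1..k} \<Longrightarrow> Q i \<noteq> {\<zero>}"
    and "\<And>i. i \<in> {1..k} \<Longrightarrow> maximalideal (M i) R"
    and "\<And>i. i \<in> {1..k} \<Longrightarrow> ideal_radical R (Q i) = M i"
    and "inj_on M {1..k}"
    and "I = (\<Otimes>\<^bsub>ideals_set R\<^esub> i\<in>{1..k}. Q i)"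
    and "I \<noteq> {\<zero>}"
  shows "crt_reduction R Q k (l + 1) ` proj_space R I (l + 1)
    = (\<Pi>\<^sub>E i\<in>{1..k}. proj_space R (Q i) (l + 1))"
proof -
  interpret cring R by (rule assms(1))
  let ?n = "l + 1"
  have Q: "ideal (Q i) R" if "i \<in> {1..k}" for i using assms(2) that .
  have M: "maximalideal (ideal_radical R (Q i)) R" if "i \<in> {1..k}" for i
    using assms(4,5) that by simp
  have inj: "inj_on (\<lambda>i. ideal_radical R (Q i)) {1..k}"
    using inj_on_cong[of "{1..k}" "\<lambda>i. ideal_radical R (Q i)" M] assms(5,6) by blast
  \<comment> \<open>On the class of a representative the reduction is computed by the same
    representative, which reduces both inclusions to statements about tuples.\<close>
  have cls: "crt_reduction R Q k ?n (proj_rel R I ?n `` {a})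
      = (\<lambda>i\<in>{1..k}. proj_rel R (Q i) ?n `` {a})" if "a \<in> unital_tuples R ?n" for a
    by (rule crt_reduction_class[OF _ _ inj assms(7) that]) (fact Q M)+
  show ?thesis
  proof (intro equalityI subsetI)
    fix D assume "D \<in> crt_reduction R Q k ?n ` proj_space R I ?n"
    then obtain a where a: "a \<in> unital_tuples R ?n"
      and D: "D = crt_reduction R Q k ?n (proj_rel R I ?n `` {a})"
      unfolding proj_space_def by (auto elim!: quotientE)
    show "D \<in> (\<Pi>\<^sub>E i\<in>{1..k}. proj_space R (Q i) ?n)"
      unfolding D cls[OF a] proj_space_def using a by (auto intro: quotientI)
  next
    fix D assume D: "D \<in> (\<Pi>\<^sub>E i\<in>{1..k}. proj_space R (Q i) ?n)"
    have "\<forall>i\<in>{1..k}. \<exists>a. a \<in> unital_tuples R ?n \<and> D i = proj_rel R (Q i) ?n `` {a}"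
    proof
      fix i assume "i \<in> {1..k}"
      with D have "D i \<in> unital_tuples R ?n // proj_rel R (Q i) ?n"
        unfolding proj_space_def by (rule PiE_mem)
      then show "\<exists>a. a \<in> unital_tuples R ?n \<and> D i = proj_rel R (Q i) ?n `` {a}"
        by (auto elim: quotientE)
    qed
    then obtain a where a: "\<And>i. i \<in> {1..k} \<Longrightarrow> a i \<in> unital_tuples R ?n"
      and Da: "\<And>i. i \<in> {1..k} \<Longrightarrow> D i = proj_rel R (Q i) ?n `` {a i}"
      using bchoice[of "{1..k}"] by metis
    \<comment> \<open>For \<open>k = 0\<close> this still provides a unital tuple, so the single
      point of the empty product is reached.\<close>
    have "\<exists>b\<in>unital_tuples R ?n. \<forall>i\<in>{1..k}. (a i, b) \<in> proj_rel R (Q i) ?n"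
      by (rule unital_chinese_remainder[OF _ _ _ inj]) (fact finite_atLeastAtMost Q M a)+
    then obtain b where b: "b \<in> unital_tuples R ?n"
      and ab: "\<And>i. i \<in> {1..k} \<Longrightarrow> (a i, b) \<in> proj_rel R (Q i) ?n" by blast
    \<comment> \<open>Equivalent tuples have equal classes, so \<open>b\<close> replaces every
      \<open>a i\<close>; outside \<open>{1..k}\<close> both sides are
      \<open>undefined\<close>.\<close>
    have "D = (\<lambda>i\<in>{1..k}. proj_rel R (Q i) ?n `` {b})"
    proof (rule extensionalityI[of _ "{1..k}"])
      show "D \<in> extensional {1..k}" using D by (simp add: PiE_def)
      show "D i = (\<lambda>i\<in>{1..k}. proj_rel R (Q i) ?n `` {b}) i" if i: "i \<in> {1..k}" for i
        using equiv_class_eq[OF proj_rel_equiv[OF Q[OF i]] ab[OF i]] Da[OF i] i by simp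
    qed simp
    then have "D = crt_reduction R Q k ?n (proj_rel R I ?n `` {b})"
      using cls[OF b] by simp
    then show "D \<in> crt_reduction R Q k ?n ` proj_space R I ?n"
      unfolding proj_space_def using b by (auto intro: quotientI)
  qed
qed

end
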